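(* Let $(X,d)$ be a Hadamard space, and let $S : X \to X$ be a strongly quasi-nonexpansive orbital $\Delta$-demiclosed mapping with $Fix(S) \neq \emptyset$. For any initial point $p_0 \in X$, let the sequence $\{x_n\}$ be defined by $x_n := S^n(p_0)$ for each $n \in \mathbb{N}$. Then the sequence $\{x_n\}$ is $\Delta$-convergent to an element $p^\ast \in Fix(S)$.
   Context: A Hadamard space is a complete $\mathrm{CAT}(0)$ space. $S^n$ denotes the $n$-th iterate of $S$. For a bounded sequence $\{x_n\}$ in $X$, the asymptotic center is $\mathcal{A}(\{x_n\}) = \{ z \in X : \limsup_{n} d(z,x_n) = \inf_{y \in X} \limsup_{n} d(y,x_n)\}$ (a singleton in a Hadamard space). A bounded sequence $\{x_n\}$ is $\Delta$-convergent to $z \in X$ (written $x_n \xrightarrow{\Delta} z$) if $\mathcal{A}(\{x_{n_i}\}) = \{z\}$ for each subsequence $\{x_{n_i}\}$ of $\{x_n\}$. For $S : X \to X$, $Fix(S) = \{x \in X : S(x) = x\}$. $S$ is quasi-nonexpansive if $Fix(S) \neq \emptyset$ and $d(S(x),q) \le d(x,q)$ for all $x \in X$ and $q \in Fix(S)$. $S$ is strongly quasi-nonexpansive if $S$ is quasi-nonexpansive and $\lim_{n\to\infty} d(x_n, S(x_n)) = 0$ whenever $\{x_n\}$ is a bounded sequence in $X$ such that $\lim_{n\to\infty}[d(x_n,q) - d(S(x_n),q)] = 0$ for some $q \in Fix(S)$. $S$ is orbital $\Delta$-demiclosed if $x^\ast \in Fix(S)$ whenever $\{x_k\}$ is a sequence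 in $X$ satisfying: (1) $x_k \xrightarrow{\Delta} x^\ast$; (2) $d(S(x_k),x_k) \to 0$; and (3) $\{x_k\}$ is a subsequence of $\{S^n(\hat{x})\}$ for some $\hat{x} \in X$. *)

theory Defs
  imports "HOL-Analysis.Analysis"
begin

text \<open>
  \<open>G\<close> is the image of a geodesic (isometric) path from \<open>x\<close> to \<open>y\<close>. A segment is not determined
  by its endpoints in a general metric space, so \<open>G\<close> is an explicit argument.
\<close>

definition (in metric_space) geodesic_segment :: "'a set \<Rightarrow> 'a \<Rightarrow> 'a \<Rightarrow> bool" where
  "geodesic_segment G x y \<longleftrightarrow>
     (\<exists>c :: real \<Rightarrow> 'a. c 0 = x \<and> c (dist x y) = y \<and>
        (\<forall>s\<in>{0..dist x y}. \<forall>t\<in>{0..dist x y}. dist (c s) (c t) = \<bar>s - t\<bar>) \<and>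
        G = c ` {0..dist x y})"

text \<open>
  \<open>p'\<close> is a comparison point of \<open>p\<close>, where \<open>p\<close> lies on the side \<open>G\<close> with endpoints \<open>x\<close>, \<open>y\<close>,
  and the Euclidean segment from \<open>x'\<close> to \<open>y'\<close> is the corresponding side of the comparison triangle.
\<close>

definition (in metric_space) comparison_on_side ::
  "'a set \<Rightarrow> 'a \<Rightarrow> real^2 \<Rightarrow> real^2 \<Rightarrow> 'a \<Rightarrow> real^2 \<Rightarrow> bool" where
  "comparison_on_side G x x' y' p p' \<longleftrightarrow>
     p \<in> G \<and> p' \<in> closed_segment x' y' \<and> dist x' p' = dist x p"

text \<open>
  The two points compared below may lie on any of the three sides \<open>G1 = [x,y]\<close>, \<open>G2 = [y,z]\<close>,
  \<open>G3 = [z,x]\<close> of the geodesic triangle.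
\<close>

class cat0_space = metric_space +
  assumes geodesic: "\<exists>G. geodesic_segment G x y"
    and cat0_inequality:
      "\<lbrakk>geodesic_segment G1 x y; geodesic_segment G2 y z; geodesic_segment G3 z x;
        dist x' y' = dist x y; dist y' z' = dist y z; dist z' x' = dist z x;
        comparison_on_side G1 x x' y' p p' \<or> comparison_on_side G2 y y' z' p p' \<or>
          comparison_on_side G3 z z' x' p p';
        comparison_on_side G1 x x' y' q q' \<or> comparison_on_side G2 y y' z' q q' \<or>
          comparison_on_side G3 z z' x' q q'\<rbrakk>
       \<Longrightarrow> dist p q \<le> dist p' q'"

class hadamard_space = cat0_space + complete_space

text \<open>
  The limit superior and infimum are taken in \<^typ>\<open>ereal\<close>; for bounded sequences they are the
  usual real ones.
\<close>

definition asymptotic_center :: "(nat \<Rightarrow> 'a::metric_space) \<Rightarrow> 'a set" where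
  "asymptotic_center x =
     {z. limsup (\<lambda>n. ereal (dist z (x n))) = (INF y. limsup (\<lambda>n. ereal (dist y (x n))))}"

definition delta_convergent_to :: "(nat \<Rightarrow> 'a::metric_space) \<Rightarrow> 'a \<Rightarrow> bool" where
  "delta_convergent_to x z \<longleftrightarrow>
     bounded (range x) \<and>
     (\<forall>r :: nat \<Rightarrow> nat. strict_mono r \<longrightarrow> asymptotic_center (x \<circ> r) = {z})"

definition Fix :: "('a \<Rightarrow> 'a) \<Rightarrow> 'a set" where
  "Fix S = {x. S x = x}"

definition quasi_nonexpansive :: "('a::metric_space \<Rightarrow> 'a) \<Rightarrow> bool" where
  "quasi_nonexpansive S \<longleftrightarrow>
     Fix S \<noteq> {} \<and> (\<forall>x. \<forall>q\<in>Fix S. dist (S x) q \<le> dist x q)"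

definition strongly_quasi_nonexpansive :: "('a::metric_space \<Rightarrow> 'a) \<Rightarrow> bool" where
  "strongly_quasi_nonexpansive S \<longleftrightarrow>
     quasi_nonexpansive S \<and>
     (\<forall>x :: nat \<Rightarrow> 'a.
        bounded (range x) \<and>
        (\<exists>q\<in>Fix S. (\<lambda>n. dist (x n) q - dist (S (x n)) q) \<longlonglongrightarrow> 0) \<longrightarrow>
        (\<lambda>n. dist (x n) (S (x n))) \<longlonglongrightarrow> 0)"

definition orbital_delta_demiclosed :: "('a::metric_space \<Rightarrow> 'a) \<Rightarrow> bool" where
  "orbital_delta_demiclosed S \<longleftrightarrow>
     (\<forall>(x :: nat \<Rightarrow> 'a) z.
        delta_convergent_to x z \<and>
        (\<lambda>k. dist (S (x k)) (x k)) \<longlonglongrightarrow> 0 \<and>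
        (\<exists>w. \<exists>r :: nat \<Rightarrow> nat. strict_mono r \<and> x = (\<lambda>n. (S ^^ n) w) \<circ> r) \<longrightarrow>
        z \<in> Fix S)"

end

theory Submission
  imports Defs "HOL-Library.Diagonal_Subsequence"
begin

text \<open>
  Along the orbit of a quasi-nonexpansive map the distance to every fixed point is decreasing, hence
  convergent. Its consecutive differences tend to \<open>0\<close>, so strong quasi-nonexpansiveness makes the
  displacement \<open>dist (x n) (S (x n))\<close> tend to \<open>0\<close>, and demiclosedness then puts every \<open>\<Delta>\<close>-limit of a
  subsequence of the orbit into \<open>Fix S\<close>.

  What remains holds for any bounded sequence in a Hadamard space whose distances to the points of a
  set \<open>F\<close> converge and whose subsequential \<open>\<Delta>\<close>-limits lie in \<open>F\<close>
  (\<open>fejer_subsequential_delta_limits\<close>), and it rests on two facts about asymptotic centers.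

  First, every bounded sequence has exactly one asymptotic center. By the midpoint inequality
  (\<open>cat0_midpoint_inequality\<close>), two points that almost realize the asymptotic radius but are far
  apart would have a midpoint that beats the radius. Almost-optimal points are therefore close to
  each other (\<open>near_centers_close\<close>): this gives uniqueness at once, and existence because
  minimizing sequences are Cauchy.

  Secondly, every bounded sequence has a \<open>\<Delta>\<close>-convergent subsequence. The asymptotic radius can only
  decrease on passing to a subsequence, and a diagonal argument produces a subsequence on which it
  can no longer decrease (\<open>regular_subsequence_exists\<close>). The center of such a subsequence is the
  center of all its subsequences.

  Now take any subsequence \<open>v\<close> of the orbit and a \<open>\<Delta>\<close>-convergent subsequence \<open>w\<close> of \<open>v\<close>, with limit
  \<open>z\<close>. Since \<open>z \<in> F\<close>, the distances from \<open>z\<close> have the same limit along \<open>w\<close>, \<open>v\<close> and the whole orbit.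
  That limit is the radius of \<open>w\<close>, which is at most the other two radii, so \<open>z\<close> is the center of all
  three. Hence every subsequence has the same center as the whole orbit, and it lies in \<open>F\<close>.
\<close>

section \<open>The midpoint inequality\<close>

text \<open>
  The side of length \<open>a\<close> is laid on the first axis, from the origin to \<open>(a, 0)\<close>. The law of cosines
  gives the abscissa \<open>s\<close> of the third vertex, and Heron's factorization shows that \<open>c\<^sup>2 - s\<^sup>2\<close>, the
  square of its height, is nonnegative. For \<open>a = 0\<close> the triangle degenerates to a segment.
\<close>

lemma euclidean_triangle_exists:
  fixes a b c :: real
  assumes "0 \<le> a" "0 \<le> b" "0 \<le> c" "a \<le> b + c" "b \<le> c + a" "c \<le> a + b"
  shows "\<exists>x y z :: real^2. dist x y = a \<and> dist y z = b \<and> dist z x = c"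
proof (cases "a = 0")
  case True
  then have "b = c" using assms by linarith
  have "dist (vector [b, 0] :: real^2) 0 = b"
    using assms by (simp add: dist_vec_def L2_set_def sum_2)
  with True \<open>b = c\<close> show ?thesis
    by (metis dist_commute dist_self)
next
  case False
  with assms have "a > 0" by simp
  define s where "s = (a\<^sup>2 + c\<^sup>2 - b\<^sup>2) / (2 * a)"
  have sa: "2 * a * s = a\<^sup>2 + c\<^sup>2 - b\<^sup>2"
    using \<open>a > 0\<close> by (simp add: s_def)
  have "(2 * a)\<^sup>2 * (c\<^sup>2 - s\<^sup>2) = (2 * a * c)\<^sup>2 - (2 * a * s)\<^sup>2"
    by (simp add: algebra_simps power2_eq_square)
  also have "\<dots> = ((a + c + b) * (a + c - b)) * ((b + a - c) * (b + c - a))"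
    unfolding sa by (simp add: algebra_simps power2_eq_square)
  also have "\<dots> \<ge> 0"
    using assms by (intro mult_nonneg_nonneg) auto
  finally have "c\<^sup>2 - s\<^sup>2 \<ge> 0"
    using \<open>a > 0\<close> by (simp add: zero_le_mult_iff)
  then have t: "(sqrt (c\<^sup>2 - s\<^sup>2))\<^sup>2 = c\<^sup>2 - s\<^sup>2" by simp
  let ?x = "0 :: real^2" and ?y = "vector [a, 0] :: real^2"
    and ?z = "vector [s, sqrt (c\<^sup>2 - s\<^sup>2)] :: real^2"
  have "dist ?x ?y = a"
    using assms by (simp add: dist_vec_def L2_set_def sum_2)
  moreover have "dist ?y ?z = b"
  proof -
    have "(a - s)\<^sup>2 + (c\<^sup>2 - s\<^sup>2) = b\<^sup>2"
      using sa by (simp add: power2_eq_square algebra_simps)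
    then show ?thesis
      using assms t by (simp add: dist_vec_def L2_set_def sum_2 dist_real_def)
  qed
  moreover have "dist ?z ?x = c"
    using assms t by (simp add: dist_vec_def L2_set_def sum_2)
  ultimately show ?thesis by blast
qed

lemma dist_midpoint_squared:
  fixes x y z :: "'a::real_inner"
  shows "(dist (midpoint x y) z)\<^sup>2 = (dist x z)\<^sup>2 / 2 + (dist y z)\<^sup>2 / 2 - (dist x y)\<^sup>2 / 4"
proof -
  have "midpoint x y - z = (1/2) *\<^sub>R ((x - z) + (y - z))"
    by (simp add: midpoint_def algebra_simps flip: scaleR_2)
  moreover have "x - y = (x - z) - (y - z)" by simp
  ultimately show ?thesis
    unfolding dist_norm power2_norm_eq_inner
    by (simp only: inner_simps) (simp add: inner_commute field_simps)
qed

text \<open>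
  This is the inequality of Bruhat and Tits, the only consequence of the \<open>CAT(0)\<close> axiom used below.
  The comparison axiom is applied to the midpoint of one side and the opposite vertex, for which
  the inequality is an equality in the Euclidean plane.
\<close>

lemma cat0_midpoint_inequality:
  fixes x y :: "'a::cat0_space"
  shows "\<exists>m. \<forall>z. (dist m z)\<^sup>2 \<le> (dist x z)\<^sup>2 / 2 + (dist y z)\<^sup>2 / 2 - (dist x y)\<^sup>2 / 4"
proof -
  obtain G1 where G1: "geodesic_segment G1 x y" using geodesic by blast
  then obtain c where c: "c 0 = x" "c (dist x y) = y" "G1 = c ` {0..dist x y}"
    "\<forall>s\<in>{0..dist x y}. \<forall>t\<in>{0..dist x y}. dist (c s) (c t) = \<bar>s - t\<bar>"
    unfolding geodesic_segment_def by blast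
  define m where "m = c (dist x y / 2)"
  have m: "m \<in> G1" unfolding m_def c(3) by auto
  have "dist (c 0) m = \<bar>0 - dist x y / 2\<bar>"
    unfolding m_def by (intro c(4)[rule_format]) auto
  then have xm: "dist x m = dist x y / 2" using c(1) by simp
  have "(dist m z)\<^sup>2 \<le> (dist x z)\<^sup>2 / 2 + (dist y z)\<^sup>2 / 2 - (dist x y)\<^sup>2 / 4" for z
  proof -
    obtain G2 where G2: "geodesic_segment G2 y z" using geodesic by blast
    obtain G3 where G3: "geodesic_segment G3 z x" using geodesic by blast
    have "\<exists>x' y' z' :: real^2. dist x' y' = dist x y \<and> dist y' z' = dist y z \<and> dist z' x' = dist z x"
    proof (rule euclidean_triangle_exists)
      show "dist x y \<le> dist y z + dist z x" by (metis dist_triangle dist_commute add.commute)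
      show "dist y z \<le> dist z x + dist x y" by (metis dist_triangle dist_commute add.commute)
      show "dist z x \<le> dist x y + dist y z" by (metis dist_triangle dist_commute add.commute)
    qed simp_all
    then obtain x' y' z' :: "real^2" where
      tri: "dist x' y' = dist x y" "dist y' z' = dist y z" "dist z' x' = dist z x"
      by blast
    \<comment> \<open>The vertex \<open>z\<close> counts as a point of the side \<open>[y, z]\<close>, with \<open>z'\<close> as its comparison point.\<close>
    obtain c2 where c2: "c2 (dist y z) = z" "G2 = c2 ` {0..dist y z}"
      using G2 unfolding geodesic_segment_def by blast
    have "c2 (dist y z) \<in> c2 ` {0..dist y z}" by (rule imageI) simp
    then have "comparison_on_side G2 y y' z' z z'"
      using tri(2) c2 by (simp add: comparison_on_side_def)
    then have on_side2: "comparison_on_side G1 x x' y' z z' \<or> comparison_on_side G2 y y' z' z z' \<or>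
        comparison_on_side G3 z z' x' z z'"
      by (intro disjI1 disjI2)
    have "comparison_on_side G1 x x' y' m (midpoint x' y')"
      using m xm tri(1) by (simp add: comparison_on_side_def dist_midpoint)
    then have on_side1: "comparison_on_side G1 x x' y' m (midpoint x' y') \<or>
        comparison_on_side G2 y y' z' m (midpoint x' y') \<or>
        comparison_on_side G3 z z' x' m (midpoint x' y')"
      by (rule disjI1)
    have "dist m z \<le> dist (midpoint x' y') z'"
      by (rule cat0_inequality[OF G1 G2 G3 tri on_side1 on_side2])
    then have "(dist m z)\<^sup>2 \<le> (dist (midpoint x' y') z')\<^sup>2"
      by (simp add: power_mono)
    moreover have "dist x' z' = dist x z"
      using tri(3) by (simp add: dist_commute)
    ultimately show ?thesis
      by (simp only: dist_midpoint_squared tri)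
  qed
  then show ?thesis by blast
qed

section \<open>Asymptotic radius and asymptotic center\<close>

text \<open>
  For a bounded sequence this is the infimum over \<open>y\<close> of the upper limits of \<open>dist y (u n)\<close>
  (\<open>Inf_limsup_eq_asymptotic_radius\<close>), expressed through eventual bounds so that the arguments
  below stay in the reals.
\<close>

definition asymptotic_radius :: "(nat \<Rightarrow> 'a::metric_space) \<Rightarrow> real" where
  "asymptotic_radius u = Inf {c. \<exists>y. \<forall>\<^sub>F n in sequentially. dist y (u n) \<le> c}"

lemma eventual_dist_bound_nonneg:
  assumes "\<forall>\<^sub>F n in sequentially. dist y (u n) \<le> c"
  shows "0 \<le> c"
proof -
  obtain n where "dist y (u n) \<le> c"
    using eventually_happens'[OF sequentially_bot assms] by blast
  with zero_le_dist[of y "u n"] show ?thesis by linarith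
qed

lemma asymptotic_radius_le:
  assumes "\<forall>\<^sub>F n in sequentially. dist y (u n) \<le> c"
  shows "asymptotic_radius u \<le> c"
  unfolding asymptotic_radius_def
proof (rule cInf_lower)
  have "0 \<le> c" if "\<forall>\<^sub>F n in sequentially. dist y (u n) \<le> c" for c y
    by (rule eventual_dist_bound_nonneg[OF that])
  then show "bdd_below {c. \<exists>y. \<forall>\<^sub>F n in sequentially. dist y (u n) \<le> c}"
    by (intro bdd_belowI[of _ 0]) auto
qed (use assms in blast)

lemma bounded_radius_nonempty:
  assumes "bounded (range u)"
  shows "{c. \<exists>y. \<forall>\<^sub>F n in sequentially. dist y (u n) \<le> c} \<noteq> {}"
proof -
  obtain y c where "\<forall>n. dist y (u n) \<le> c"
    using assms unfolding bounded_def by blast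
  then have "\<forall>\<^sub>F n in sequentially. dist y (u n) \<le> c" by simp
  then show ?thesis by blast
qed

lemma asymptotic_radius_nonneg:
  assumes "bounded (range u)"
  shows "0 \<le> asymptotic_radius u"
  unfolding asymptotic_radius_def
proof (rule cInf_greatest[OF bounded_radius_nonempty[OF assms]])
  fix c assume "c \<in> {c. \<exists>y. \<forall>\<^sub>F n in sequentially. dist y (u n) \<le> c}"
  then obtain y where "\<forall>\<^sub>F n in sequentially. dist y (u n) \<le> c" by blast
  then show "0 \<le> c" by (rule eventual_dist_bound_nonneg)
qed

lemma asymptotic_radius_approx:
  assumes "bounded (range u)" "e > 0"
  obtains y where "\<forall>\<^sub>F n in sequentially. dist y (u n) \<le> asymptotic_radius u + e"
proof -
  obtain c y where "c < asymptotic_radius u + e" "\<forall>\<^sub>F n in sequentially. dist y (u n) \<le> c"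
    using cInf_lessD[OF bounded_radius_nonempty[OF assms(1)], of "asymptotic_radius u + e"] assms(2)
    unfolding asymptotic_radius_def by auto
  then show ?thesis
    by (intro that[of y]) (auto elim: eventually_mono)
qed

lemma bounded_subseq: "bounded (range u) \<Longrightarrow> bounded (range (u \<circ> r))"
  by (erule bounded_subset) auto

lemma asymptotic_radius_subseq_le:
  assumes "bounded (range u)" "strict_mono r"
  shows "asymptotic_radius (u \<circ> r) \<le> asymptotic_radius u"
proof (rule field_le_epsilon)
  fix e :: real assume "e > 0"
  then obtain y where "\<forall>\<^sub>F n in sequentially. dist y (u n) \<le> asymptotic_radius u + e"
    using asymptotic_radius_approx assms(1) by blast
  then have "\<forall>\<^sub>F n in sequentially. dist y ((u \<circ> r) n) \<le> asymptotic_radius u + e"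
    using eventually_subseq[OF assms(2)] by simp
  then show "asymptotic_radius (u \<circ> r) \<le> asymptotic_radius u + e"
    by (rule asymptotic_radius_le)
qed

lemma Inf_limsup_eq_asymptotic_radius:
  assumes "bounded (range u)"
  shows "(INF y. limsup (\<lambda>n. ereal (dist y (u n)))) = ereal (asymptotic_radius u)"
proof (rule antisym)
  show "(INF y. limsup (\<lambda>n. ereal (dist y (u n)))) \<le> ereal (asymptotic_radius u)"
  proof (rule ereal_le_epsilon2)
    fix e :: real assume "e > 0"
    then obtain y where "\<forall>\<^sub>F n in sequentially. dist y (u n) \<le> asymptotic_radius u + e"
      using asymptotic_radius_approx assms by blast
    then have "limsup (\<lambda>n. ereal (dist y (u n))) \<le> ereal (asymptotic_radius u) + ereal e"
      by (intro Limsup_bounded) simp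
    then show "(INF y. limsup (\<lambda>n. ereal (dist y (u n)))) \<le> ereal (asymptotic_radius u) + ereal e"
      by (rule INF_lower2[OF UNIV_I])
  qed
  show "ereal (asymptotic_radius u) \<le> (INF y. limsup (\<lambda>n. ereal (dist y (u n))))"
  proof (rule INF_greatest, rule ccontr)
    fix y assume "\<not> ereal (asymptotic_radius u) \<le> limsup (\<lambda>n. ereal (dist y (u n)))"
    then obtain c where c: "limsup (\<lambda>n. ereal (dist y (u n))) < ereal c" "c < asymptotic_radius u"
      using ereal_dense2[of "limsup (\<lambda>n. ereal (dist y (u n)))" "ereal (asymptotic_radius u)"]
      by (auto simp: not_le)
    have "\<forall>\<^sub>F n in sequentially. dist y (u n) \<le> c"
      using Limsup_lessD[OF c(1)] by (auto elim: eventually_mono)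
    then show False
      using asymptotic_radius_le c(2) by fastforce
  qed
qed

text \<open>
  Only the upper bound has to be required: the infimum over all points can never exceed the upper
  limit belonging to \<open>z\<close>.
\<close>

lemma mem_asymptotic_center_iff:
  assumes "bounded (range u)"
  shows "z \<in> asymptotic_center u \<longleftrightarrow>
    (\<forall>e>0. \<forall>\<^sub>F n in sequentially. dist z (u n) \<le> asymptotic_radius u + e)"
proof -
  let ?L = "limsup (\<lambda>n. ereal (dist z (u n)))"
  have "z \<in> asymptotic_center u \<longleftrightarrow> ?L \<le> ereal (asymptotic_radius u)"
    unfolding asymptotic_center_def mem_Collect_eq Inf_limsup_eq_asymptotic_radius[OF assms, symmetric]
    by (metis (mono_tags, lifting) INF_lower UNIV_I antisym order_refl)
  also have "\<dots> \<longleftrightarrow> (\<forall>e>0. \<forall>\<^sub>F n in sequentially. dist z (u n) \<le> asymptotic_radius u + e)"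
  proof (intro iffI allI impI)
    fix e :: real assume "?L \<le> ereal (asymptotic_radius u)" "e > 0"
    then have "?L < ereal (asymptotic_radius u + e)"
      by (meson ereal_less_le less_add_same_cancel1 less_ereal.simps(1) order_le_less_trans)
    from Limsup_lessD[OF this] show "\<forall>\<^sub>F n in sequentially. dist z (u n) \<le> asymptotic_radius u + e"
      by (auto elim: eventually_mono)
  next
    assume *: "\<forall>e>0. \<forall>\<^sub>F n in sequentially. dist z (u n) \<le> asymptotic_radius u + e"
    show "?L \<le> ereal (asymptotic_radius u)"
    proof (rule ereal_le_epsilon2)
      fix e :: real assume "e > 0"
      then show "?L \<le> ereal (asymptotic_radius u) + ereal e"
        using * by (intro Limsup_bounded) simp
    qed
  qed
  finally show ?thesis .
qed

text \<open>
  If both points are eventually within \<open>R + e\<close> of the sequence, where \<open>R\<close> is the radius, their midpoint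
  is eventually within the square root of \<open>(R + e)\<^sup>2 - (dist y z)\<^sup>2 / 4\<close>. This cannot be less than \<open>R\<close>.
\<close>

lemma near_centers_close:
  fixes u :: "nat \<Rightarrow> 'a::cat0_space"
  assumes "bounded (range u)"
    and y: "\<forall>\<^sub>F n in sequentially. dist y (u n) \<le> asymptotic_radius u + e"
    and z: "\<forall>\<^sub>F n in sequentially. dist z (u n) \<le> asymptotic_radius u + e"
  shows "(dist y z)\<^sup>2 \<le> 4 * e * (2 * asymptotic_radius u + e)"
proof -
  let ?R = "asymptotic_radius u"
  let ?c = "(?R + e)\<^sup>2 - (dist y z)\<^sup>2 / 4"
  have R: "0 \<le> ?R" by (rule asymptotic_radius_nonneg) fact
  obtain m where m: "\<And>p. (dist m p)\<^sup>2 \<le> (dist y p)\<^sup>2 / 2 + (dist z p)\<^sup>2 / 2 - (dist y z)\<^sup>2 / 4"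
    using cat0_midpoint_inequality by blast
  have ev: "\<forall>\<^sub>F n in sequentially. (dist m (u n))\<^sup>2 \<le> ?c"
    using y z
  proof eventually_elim
    case (elim n)
    then have "(dist y (u n))\<^sup>2 \<le> (?R + e)\<^sup>2" "(dist z (u n))\<^sup>2 \<le> (?R + e)\<^sup>2"
      by (auto intro: power_mono)
    with m[of "u n"] show ?case by linarith
  qed
  obtain n where "(dist m (u n))\<^sup>2 \<le> ?c"
    using eventually_happens'[OF sequentially_bot ev] by blast
  with zero_le_power2[of "dist m (u n)"] have "0 \<le> ?c" by linarith
  have "\<forall>\<^sub>F n in sequentially. dist m (u n) \<le> sqrt ?c"
    using ev by eventually_elim (rule real_le_rsqrt)
  then have "?R \<le> sqrt ?c" by (rule asymptotic_radius_le)
  then have "?R\<^sup>2 \<le> ?c"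
    using R \<open>0 \<le> ?c\<close> by (metis power_mono real_sqrt_pow2)
  then show ?thesis by (simp add: power2_eq_square algebra_simps)
qed

lemma near_center_bound_tendsto_0:
  fixes R :: real
  shows "(\<lambda>k. 4 * (1 / real (Suc k)) * (2 * R + 1 / real (Suc k))) \<longlonglongrightarrow> 0"
proof -
  have "(\<lambda>k. 1 / real (Suc k)) \<longlonglongrightarrow> 0" by (rule LIMSEQ_Suc[OF lim_1_over_n])
  then have "(\<lambda>k. 4 * (1 / real (Suc k)) * (2 * R + 1 / real (Suc k))) \<longlonglongrightarrow> 4 * 0 * (2 * R + 0)"
    by (intro tendsto_mult tendsto_add tendsto_const)
  then show ?thesis by simp
qed

lemma asymptotic_center_unique:
  fixes u :: "nat \<Rightarrow> 'a::cat0_space"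
  assumes b: "bounded (range u)" and y: "y \<in> asymptotic_center u" and z: "z \<in> asymptotic_center u"
  shows "y = z"
proof -
  let ?R = "asymptotic_radius u"
  have near: "(dist y z)\<^sup>2 \<le> 4 * e * (2 * ?R + e)" if e: "e > 0" for e
  proof (rule near_centers_close[OF b])
    show "\<forall>\<^sub>F n in sequentially. dist y (u n) \<le> ?R + e"
      using y e by (simp only: mem_asymptotic_center_iff[OF b])
    show "\<forall>\<^sub>F n in sequentially. dist z (u n) \<le> ?R + e"
      using z e by (simp only: mem_asymptotic_center_iff[OF b])
  qed
  have "(dist y z)\<^sup>2 \<le> 0"
  proof (rule LIMSEQ_le_const[OF near_center_bound_tendsto_0], intro exI allI impI)
    fix k
    show "(dist y z)\<^sup>2 \<le> 4 * (1 / real (Suc k)) * (2 * ?R + 1 / real (Suc k))"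
      by (rule near) simp
  qed
  then show ?thesis by simp
qed

text \<open>
  A minimizing sequence for the radius is Cauchy by \<open>near_centers_close\<close>, and its limit is a center.
\<close>

lemma asymptotic_center_exists:
  fixes u :: "nat \<Rightarrow> 'a::hadamard_space"
  assumes b: "bounded (range u)"
  shows "\<exists>z. z \<in> asymptotic_center u"
proof -
  let ?R = "asymptotic_radius u"
  let ?e = "\<lambda>k. 1 / real (Suc k)"
  have "\<exists>y. \<forall>\<^sub>F n in sequentially. dist y (u n) \<le> ?R + ?e k" for k
  proof -
    have "0 < ?e k" by simp
    then obtain y where "\<forall>\<^sub>F n in sequentially. dist y (u n) \<le> ?R + ?e k"
      using asymptotic_radius_approx[OF b] by blast
    then show ?thesis ..
  qed
  then obtain y where y: "\<And>k. \<forall>\<^sub>F n in sequentially. dist (y k) (u n) \<le> ?R + ?e k"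
    by metis
  have e0: "?e \<longlonglongrightarrow> 0" by (rule LIMSEQ_Suc[OF lim_1_over_n])
  have close: "(dist (y i) (y j))\<^sup>2 \<le> 4 * ?e k * (2 * ?R + ?e k)" if "k \<le> i" "k \<le> j" for i j k
  proof -
    have "\<forall>\<^sub>F n in sequentially. dist (y l) (u n) \<le> ?R + ?e k" if "k \<le> l" for l
    proof -
      have "?e l \<le> ?e k" using that by (simp add: frac_le)
      with y[of l] show ?thesis by (auto elim!: eventually_mono)
    qed
    then show ?thesis using that by (intro near_centers_close[OF b]) auto
  qed
  have "Cauchy y"
  proof (rule metric_CauchyI)
    fix d :: real assume "d > 0"
    have "0 < d\<^sup>2" using \<open>d > 0\<close> by simp
    then have "\<forall>\<^sub>F k in sequentially. 4 * ?e k * (2 * ?R + ?e k) < d\<^sup>2"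
      by (rule order_tendstoD(2)[OF near_center_bound_tendsto_0])
    then obtain k where k: "4 * ?e k * (2 * ?R + ?e k) < d\<^sup>2"
      using eventually_happens'[OF sequentially_bot] by blast
    have "dist (y i) (y j) < d" if "k \<le> i" "k \<le> j" for i j
      using close[OF that] k \<open>d > 0\<close> by (intro power2_less_imp_less[of _ d]) auto
    then show "\<exists>M. \<forall>m\<ge>M. \<forall>n\<ge>M. dist (y m) (y n) < d" by blast
  qed
  then obtain z where z: "y \<longlonglongrightarrow> z"
    using Cauchy_convergent convergent_def by blast
  have "\<forall>\<^sub>F n in sequentially. dist z (u n) \<le> ?R + e" if "e > 0" for e
  proof -
    have "\<forall>\<^sub>F k in sequentially. dist (y k) z < e / 2"
      using tendstoD[OF z, of "e / 2"] that by simp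
    moreover have "\<forall>\<^sub>F k in sequentially. ?e k < e / 2"
      using order_tendstoD(2)[OF e0, of "e / 2"] that by simp
    ultimately obtain k where k: "dist (y k) z < e / 2" "?e k < e / 2"
      using eventually_happens'[OF sequentially_bot eventually_conj] by blast
    show ?thesis
      using y[of k]
    proof eventually_elim
      case (elim n)
      then show ?case using dist_triangle3[of z "u n" "y k"] k by linarith
    qed
  qed
  then show ?thesis using mem_asymptotic_center_iff[OF b] by blast
qed

section \<open>Regular and \<open>\<Delta>\<close>-convergent subsequences\<close>

text \<open>
  For a fixed \<open>n\<close>, some subsequence has the property \<open>P n\<close> that no further subsequence lowers its
  radius by more than \<open>1 / Suc n\<close>: choose one whose radius is within \<open>1 / Suc n\<close> of the infimum over
  all subsequences. As \<open>P n\<close> is inherited by subsequences, tails of the diagonal sequence satisfy all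
  the \<open>P n\<close>, and radii do not see the difference between a sequence and its tails.
\<close>

lemma regular_subsequence_exists:
  fixes u :: "nat \<Rightarrow> 'a::metric_space"
  assumes b: "bounded (range u)"
  obtains d where "strict_mono d"
    "\<And>r. strict_mono r \<Longrightarrow> asymptotic_radius (u \<circ> d \<circ> r) = asymptotic_radius (u \<circ> d)"
proof -
  let ?R = asymptotic_radius
  define P where "P = (\<lambda>n s. \<forall>r :: nat \<Rightarrow> nat. strict_mono r \<longrightarrow>
      ?R (u \<circ> s) \<le> ?R (u \<circ> s \<circ> r) + 1 / real (Suc n))"
  have bs: "bounded (range (u \<circ> s))" for s :: "nat \<Rightarrow> nat" by (rule bounded_subseq[OF b])
  interpret subseqs P
  proof
    fix n and s :: "nat \<Rightarrow> nat"
    let ?A = "(\<lambda>r. ?R (u \<circ> s \<circ> r)) ` {r. strict_mono r}"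
    have ne: "?A \<noteq> {}" using strict_mono_id by blast
    have bdd: "bdd_below ?A"
      using asymptotic_radius_nonneg[OF bounded_subseq[OF bs]]
      by (intro bdd_belowI[of _ 0]) auto
    have "Inf ?A < Inf ?A + 1 / real (Suc n)" by simp
    then obtain r where r: "strict_mono r" "?R (u \<circ> s \<circ> r) < Inf ?A + 1 / real (Suc n)"
      using cInf_lessD[OF ne] by blast
    have "P n (s \<circ> r)"
      unfolding P_def
    proof (intro allI impI)
      fix t :: "nat \<Rightarrow> nat" assume "strict_mono t"
      then have "Inf ?A \<le> ?R (u \<circ> s \<circ> (r \<circ> t))"
        using r(1) by (intro cInf_lower[OF _ bdd]) (auto intro: strict_mono_o)
      with r(2) show "?R (u \<circ> (s \<circ> r)) \<le> ?R (u \<circ> (s \<circ> r) \<circ> t) + 1 / real (Suc n)"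
        by (simp add: o_assoc)
    qed
    with r(1) show "\<exists>r'. strict_mono r' \<and> P n (s \<circ> r')" by blast
  qed
  have P_subseq: "P n (s \<circ> r)" if "strict_mono r" "P n s" for n s r
    unfolding P_def
  proof (intro allI impI)
    fix t :: "nat \<Rightarrow> nat" assume "strict_mono t"
    then have "?R (u \<circ> s) \<le> ?R (u \<circ> s \<circ> (r \<circ> t)) + 1 / real (Suc n)"
      using that by (auto simp: P_def intro: strict_mono_o)
    with asymptotic_radius_subseq_le[OF bs that(1), of s]
    show "?R (u \<circ> (s \<circ> r)) \<le> ?R (u \<circ> (s \<circ> r) \<circ> t) + 1 / real (Suc n)"
      by (simp add: o_assoc)
  qed
  have tail: "P n (diagseq \<circ> (+) (Suc n))" for n
    using diagseq_holds[of n] P_subseq by blast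
  have tail_le: "?R (u \<circ> s) \<le> ?R (u \<circ> s \<circ> (+) k)" for s k
  proof (rule field_le_epsilon)
    fix e :: real assume "e > 0"
    then obtain y where "\<forall>\<^sub>F n in sequentially. dist y ((u \<circ> s \<circ> (+) k) n) \<le> ?R (u \<circ> s \<circ> (+) k) + e"
      using asymptotic_radius_approx[OF bounded_subseq[OF bs]] by blast
    then have "\<forall>\<^sub>F n in sequentially. dist y ((u \<circ> s) (n + k)) \<le> ?R (u \<circ> s \<circ> (+) k) + e"
      by (simp add: add.commute)
    then have "\<forall>\<^sub>F n in sequentially. dist y ((u \<circ> s) n) \<le> ?R (u \<circ> s \<circ> (+) k) + e"
      by (subst (asm) eventually_sequentially_seg)
    then show "?R (u \<circ> s) \<le> ?R (u \<circ> s \<circ> (+) k) + e" by (rule asymptotic_radius_le)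
  qed
  show ?thesis
  proof (rule that[OF subseq_diagseq])
    fix r :: "nat \<Rightarrow> nat" assume r: "strict_mono r"
    show "?R (u \<circ> diagseq \<circ> r) = ?R (u \<circ> diagseq)"
    proof (rule antisym)
      show "?R (u \<circ> diagseq \<circ> r) \<le> ?R (u \<circ> diagseq)"
        by (rule asymptotic_radius_subseq_le[OF bs r])
      have le: "?R (u \<circ> diagseq) \<le> ?R (u \<circ> diagseq \<circ> r) + 1 / real (Suc n)" for n
      proof -
        let ?k = "Suc n"
        \<comment> \<open>A tail of a subsequence of \<open>diagseq\<close> is a subsequence, along \<open>t\<close>, of the tail with \<open>P n\<close>.\<close>
        define t where "t i = r (?k + i) - ?k" for i
        have ge: "?k + i \<le> r (?k + i)" for i
          using r by (rule strict_mono_imp_increasing)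
        have t: "strict_mono t"
          unfolding strict_mono_Suc_iff
        proof
          fix i
          have "r (?k + i) < r (?k + Suc i)" using r by (simp add: strict_mono_def)
          with ge[of i] show "t i < t (Suc i)" unfolding t_def by linarith
        qed
        have eq: "diagseq \<circ> r \<circ> (+) ?k = diagseq \<circ> (+) ?k \<circ> t"
        proof
          fix i
          show "(diagseq \<circ> r \<circ> (+) ?k) i = (diagseq \<circ> (+) ?k \<circ> t) i"
            using ge[of i] by (simp add: t_def)
        qed
        have "?R (u \<circ> diagseq) \<le> ?R (u \<circ> diagseq \<circ> (+) ?k)" by (rule tail_le)
        moreover have "?R (u \<circ> diagseq \<circ> (+) ?k) \<le> ?R (u \<circ> (diagseq \<circ> (+) ?k) \<circ> t) + 1 / real (Suc n)"
          using tail[of n] t by (simp add: P_def o_assoc)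
        moreover have "?R (u \<circ> (diagseq \<circ> (+) ?k) \<circ> t) = ?R (u \<circ> diagseq \<circ> r \<circ> (+) ?k)"
          using eq by (simp add: o_assoc[symmetric])
        moreover have "?R (u \<circ> diagseq \<circ> r \<circ> (+) ?k) \<le> ?R (u \<circ> diagseq \<circ> r)"
          by (rule asymptotic_radius_subseq_le[OF bounded_subseq[OF bs]]) (simp add: strict_mono_def)
        ultimately show ?thesis by linarith
      qed
      show "?R (u \<circ> diagseq) \<le> ?R (u \<circ> diagseq \<circ> r)"
      proof (rule field_le_epsilon)
        fix e :: real assume "e > 0"
        then obtain n where "1 / real (Suc n) < e" using nat_approx_posE by blast
        with le[of n] show "?R (u \<circ> diagseq) \<le> ?R (u \<circ> diagseq \<circ> r) + e" by linarith
      qed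
    qed
  qed
qed

text \<open>
  On a regular subsequence all further subsequences have the same radius, so the bound that makes
  \<open>z\<close> a center of the regular subsequence makes it a center of each of them.
\<close>

lemma delta_convergent_subsequence_exists:
  fixes u :: "nat \<Rightarrow> 'a::hadamard_space"
  assumes b: "bounded (range u)"
  obtains d z where "strict_mono d" "delta_convergent_to (u \<circ> d) z"
proof -
  obtain d where d: "strict_mono d"
    "\<And>r. strict_mono r \<Longrightarrow> asymptotic_radius (u \<circ> d \<circ> r) = asymptotic_radius (u \<circ> d)"
    using regular_subsequence_exists[OF b] by blast
  have bd: "bounded (range (u \<circ> d))" by (rule bounded_subseq[OF b])
  obtain z where z: "z \<in> asymptotic_center (u \<circ> d)" using asymptotic_center_exists[OF bd] by blast
  have "asymptotic_center (u \<circ> d \<circ> r) = {z}" if r: "strict_mono r" for r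
  proof -
    have br: "bounded (range (u \<circ> d \<circ> r))" by (rule bounded_subseq[OF bd])
    have "\<forall>\<^sub>F n in sequentially. dist z ((u \<circ> d \<circ> r) n) \<le> asymptotic_radius (u \<circ> d \<circ> r) + e"
      if "e > 0" for e
      using z mem_asymptotic_center_iff[OF bd] that d(2)[OF r]
        eventually_subseq[OF r, of "\<lambda>n. dist z ((u \<circ> d) n) \<le> asymptotic_radius (u \<circ> d) + e"]
      by simp
    then have "z \<in> asymptotic_center (u \<circ> d \<circ> r)"
      using mem_asymptotic_center_iff[OF br] by blast
    then show ?thesis using asymptotic_center_unique[OF br] by blast
  qed
  then have "delta_convergent_to (u \<circ> d) z"
    using bd by (simp add: delta_convergent_to_def)
  with d(1) show ?thesis by (rule that)
qed

text \<open>
  The limit of \<open>dist (u n) z\<close> can be computed along the subsequence, where it is at most the radius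
  of the subsequence and hence at most that of \<open>u\<close>.
\<close>

lemma delta_limit_is_center_of_supersequence:
  fixes u :: "nat \<Rightarrow> 'a::metric_space"
  assumes b: "bounded (range u)" and r: "strict_mono r"
    and z: "delta_convergent_to (u \<circ> r) z" and conv: "convergent (\<lambda>n. dist (u n) z)"
  shows "z \<in> asymptotic_center u"
proof -
  obtain l where l: "(\<lambda>n. dist (u n) z) \<longlonglongrightarrow> l" using conv convergent_def by blast
  have br: "bounded (range (u \<circ> r))" by (rule bounded_subseq[OF b])
  have "asymptotic_center (u \<circ> r \<circ> id) = {z}"
    using z strict_mono_id unfolding delta_convergent_to_def by blast
  then have zc: "z \<in> asymptotic_center (u \<circ> r)" by simp
  have "l \<le> asymptotic_radius (u \<circ> r)"
  proof (rule field_le_epsilon)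
    fix e :: real assume "e > 0"
    then have "\<forall>\<^sub>F n in sequentially. ((\<lambda>n. dist (u n) z) \<circ> r) n \<le> asymptotic_radius (u \<circ> r) + e"
      using zc mem_asymptotic_center_iff[OF br] by (simp add: dist_commute)
    then show "l \<le> asymptotic_radius (u \<circ> r) + e"
      by (rule tendsto_upperbound[OF LIMSEQ_subseq_LIMSEQ[OF l r]]) simp
  qed
  also have "\<dots> \<le> asymptotic_radius u" by (rule asymptotic_radius_subseq_le[OF b r])
  finally have le: "l \<le> asymptotic_radius u" .
  have "\<forall>\<^sub>F n in sequentially. dist z (u n) \<le> asymptotic_radius u + e" if "e > 0" for e
  proof -
    have "\<forall>\<^sub>F n in sequentially. dist (u n) z < asymptotic_radius u + e"
      using order_tendstoD(2)[OF l] le that by simp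
    then show ?thesis by eventually_elim (simp add: dist_commute)
  qed
  then show ?thesis using mem_asymptotic_center_iff[OF b] by blast
qed

text \<open>
  A point of \<open>F\<close> that is the \<open>\<Delta>\<close>-limit of a subsequence of \<open>u \<circ> v\<close> is a center of both \<open>u \<circ> v\<close> and \<open>u\<close>.
  Uniqueness of the center of \<open>u\<close> makes it independent of \<open>v\<close>.
\<close>

lemma fejer_subsequential_delta_limits:
  fixes u :: "nat \<Rightarrow> 'a::hadamard_space"
  assumes b: "bounded (range u)"
    and conv: "\<And>q. q \<in> F \<Longrightarrow> convergent (\<lambda>n. dist (u n) q)"
    and lim: "\<And>r z. strict_mono r \<Longrightarrow> delta_convergent_to (u \<circ> r) z \<Longrightarrow> z \<in> F"
  shows "\<exists>p\<in>F. delta_convergent_to u p"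
proof -
  have common: "\<exists>z\<in>F. z \<in> asymptotic_center u \<and> z \<in> asymptotic_center (u \<circ> v)"
    if v: "strict_mono v" for v
  proof -
    have bv: "bounded (range (u \<circ> v))" by (rule bounded_subseq[OF b])
    obtain d z where d: "strict_mono d" and z: "delta_convergent_to (u \<circ> v \<circ> d) z"
      using delta_convergent_subsequence_exists[OF bv] by blast
    have vd: "strict_mono (v \<circ> d)" using v d by (rule strict_mono_o)
    have z': "delta_convergent_to (u \<circ> (v \<circ> d)) z" using z by (simp add: o_assoc)
    have zF: "z \<in> F" using lim[OF vd z'] .
    have "convergent (\<lambda>n. dist ((u \<circ> v) n) z)"
      using convergent_subseq_convergent[OF conv[OF zF] v] by (simp add: o_def)
    from delta_limit_is_center_of_supersequence[OF bv d z this]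
      delta_limit_is_center_of_supersequence[OF b vd z' conv[OF zF]] zF
    show ?thesis by blast
  qed
  obtain p where p: "p \<in> F" "p \<in> asymptotic_center u"
    using common[OF strict_mono_id] by blast
  have "asymptotic_center (u \<circ> v) = {p}" if "strict_mono v" for v
    using common[OF that] asymptotic_center_unique[OF b p(2)]
      asymptotic_center_unique[OF bounded_subseq[OF b]] by blast
  with p b show ?thesis unfolding delta_convergent_to_def by blast
qed

section \<open>Orbits of strongly quasi-nonexpansive maps\<close>

theorem theorem1:
  fixes S :: "'a::hadamard_space \<Rightarrow> 'a"
    and p0 :: 'a
    and x :: "nat \<Rightarrow> 'a"
  assumes "strongly_quasi_nonexpansive S"
    and "orbital_delta_demiclosed S"
    and "Fix S \<noteq> {}"
    and "\<And>n. x n = (S ^^ n) p0"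
  shows "\<exists>p\<in>Fix S. delta_convergent_to x p"
proof -
  have x: "x = (\<lambda>n. (S ^^ n) p0)" using assms(4) by blast
  have step: "S (x n) = x (Suc n)" for n by (simp add: x)
  have nonexp: "dist (S y) q \<le> dist y q" if "q \<in> Fix S" for y q
    using assms(1) that unfolding strongly_quasi_nonexpansive_def quasi_nonexpansive_def by blast
  have dec: "decseq (\<lambda>n. dist (x n) q)" if "q \<in> Fix S" for q
    unfolding decseq_Suc_iff step[symmetric] using nonexp[OF that] by blast
  have conv: "convergent (\<lambda>n. dist (x n) q)" if q: "q \<in> Fix S" for q
  proof -
    obtain l where "(\<lambda>n. dist (x n) q) \<longlonglongrightarrow> l"
      by (rule decseq_convergent[OF dec[OF q], of 0]) simp_all
    then show ?thesis by (rule convergentI)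
  qed
  obtain q where q: "q \<in> Fix S" using assms(3) by blast
  have "dist q (x n) \<le> dist (x 0) q" for n
    using decseqD[OF dec[OF q], of 0 n] by (simp add: dist_commute)
  then have b: "bounded (range x)" unfolding bounded_def by blast
  obtain l where l: "(\<lambda>n. dist (x n) q) \<longlonglongrightarrow> l" using conv[OF q] convergent_def by blast
  have "(\<lambda>n. dist (x n) q - dist (S (x n)) q) \<longlonglongrightarrow> 0"
    using tendsto_diff[OF l LIMSEQ_Suc[OF l]] by (simp add: step)
  with assms(1) q b have reg: "(\<lambda>n. dist (x n) (S (x n))) \<longlonglongrightarrow> 0"
    unfolding strongly_quasi_nonexpansive_def by blast
  have "z \<in> Fix S" if r: "strict_mono r" and z: "delta_convergent_to (x \<circ> r) z" for r z
  proof -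
    have "(\<lambda>k. dist (S ((x \<circ> r) k)) ((x \<circ> r) k)) \<longlonglongrightarrow> 0"
      using LIMSEQ_subseq_LIMSEQ[OF reg r] by (simp add: o_def dist_commute)
    moreover have "\<exists>w. \<exists>r' :: nat \<Rightarrow> nat. strict_mono r' \<and> x \<circ> r = (\<lambda>n. (S ^^ n) w) \<circ> r'"
      using r x by blast
    ultimately show ?thesis
      using assms(2) z unfolding orbital_delta_demiclosed_def by blast
  qed
  then show ?thesis
    using fejer_subsequential_delta_limits[OF b conv] by blast
qed

end
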